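(* Let $n\ge2$, let $s_0\in\mathbb{C}$ with $|s_0|\le1$, and let $$U^0=\begin{bmatrix}s_0&(1-|s_0|^2)^{1/2}&0_{1\times(n-1)}\\ c_1&d_{11}&d_{12}\\ c_2&d_{21}&d_{22}\end{bmatrix}$$ be a unitary $(n+1)\times(n+1)$ matrix, where $c_1,d_{11}\in\mathfrak{M}_{1\times1}$, $d_{12}\in\mathfrak{M}_{1\times(n-1)}$, $c_2,d_{21}\in\mathfrak{M}_{(n-1)\times1}$, $d_{22}\in\mathfrak{M}_{(n-1)\times(n-1)}$. Then the equation $$U^0=\begin{bmatrix}1&0&0_{1\times(n-1)}\\ 0&\alpha&\beta\\ 0_{(n-1)\times1}&\gamma&\delta\end{bmatrix}\begin{bmatrix}s_0&(1-|s_0|^2)^{1/2}&0_{1\times(n-1)}\\ (1-|s_0|^2)^{1/2}&-\overline{s_0}&0_{1\times(n-1)}\\ 0_{(n-1)\times1}&0_{(n-1)\times1}&I_{n-1}\end{bmatrix},$$ where $\alpha\in\mathfrak{M}_{1\times1}$, $\beta\in\mathfrak{M}_{1\times(n-1)}$, $\gamma\in\mathfrak{M}_{(n-1)\times1}$, $\delta\in\mathfrak{M}_{(n-1)\times(n-1)}$, has a solution with respect to the matrix $U^1=\begin{bmatrix}\alpha&\beta\\ \gamma&\delta\end{bmatrix}$. The solution of this equation can be expressed as $$\begin{bmatrix}\alpha&\beta\\ \gamma&\delta\end{bmatrix}=\begin{bmatrix}-d_{11}s_0+c_1(1-|s_0|^2)^{1/2}&d_{12}\\ -d_{21}s_0+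c_2(1-|s_0|^2)^{1/2}&d_{22}\end{bmatrix}.$$
   Context: $\mathfrak{M}_{p\times q}$ is the set of complex $p\times q$ matrices; $0_{p\times q}$ is the zero matrix of that size; $I_{n-1}$ is the identity matrix of size $n-1$. *)

theory Defs
  imports "Jordan_Normal_Form.Schur_Decomposition"
begin

definition unitary_mat :: "nat \<Rightarrow> complex mat \<Rightarrow> bool" where
  "unitary_mat m A \<longleftrightarrow> A \<in> carrier_mat m m \<and>
     mat_adjoint A * A = 1\<^sub>m m \<and> A * mat_adjoint A = 1\<^sub>m m"

definition mat11 :: "complex \<Rightarrow> complex mat" where
  "mat11 z = mat 1 1 (\<lambda>_. z)"

definition append_cols :: "'a :: zero mat \<Rightarrow> 'a mat \<Rightarrow> 'a mat" where
  "append_cols A B = four_block_mat A B (0\<^sub>m 0 (dim_col A)) (0\<^sub>m 0 (dim_col B))"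

text \<open>The blocks are listed row by row. As for \<^const>\<open>four_block_mat\<close>, the arguments must be of
  matching sizes, which are those of the diagonal blocks.\<close>

definition nine_block_mat ::
  "'a :: zero mat \<Rightarrow> 'a mat \<Rightarrow> 'a mat \<Rightarrow>
   'a mat \<Rightarrow> 'a mat \<Rightarrow> 'a mat \<Rightarrow>
   'a mat \<Rightarrow> 'a mat \<Rightarrow> 'a mat \<Rightarrow> 'a mat" where
  "nine_block_mat A11 A12 A13 A21 A22 A23 A31 A32 A33 =
     four_block_mat A11 (append_cols A12 A13) (A21 @\<^sub>r A31) (four_block_mat A22 A23 A32 A33)"

lemma nine_block_mat_carrier:
  assumes "A11 \<in> carrier_mat p1 q1" "A22 \<in> carrier_mat p2 q2" "A33 \<in> carrier_mat p3 q3"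
  shows "nine_block_mat A11 A12 A13 A21 A22 A23 A31 A32 A33 \<in> carrier_mat (p1 + p2 + p3) (q1 + q2 + q3)"
  using assms by (auto simp: nine_block_mat_def)

lemma nine_block_mat_index:
  assumes "A11 \<in> carrier_mat p1 q1" "A12 \<in> carrier_mat p1 q2" "A13 \<in> carrier_mat p1 q3"
    and "A21 \<in> carrier_mat p2 q1" "A22 \<in> carrier_mat p2 q2" "A23 \<in> carrier_mat p2 q3"
    and "A31 \<in> carrier_mat p3 q1" "A32 \<in> carrier_mat p3 q2" "A33 \<in> carrier_mat p3 q3"
    and "i < p1 + p2 + p3" "j < q1 + q2 + q3"
  shows "nine_block_mat A11 A12 A13 A21 A22 A23 A31 A32 A33 $$ (i, j) =
    (if i < p1 then
       if j < q1 then A11 $$ (i, j) else if j < q1 + q2 then A12 $$ (i, j - q1)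
       else A13 $$ (i, j - q1 - q2)
     else if i < p1 + p2 then
       if j < q1 then A21 $$ (i - p1, j) else if j < q1 + q2 then A22 $$ (i - p1, j - q1)
       else A23 $$ (i - p1, j - q1 - q2)
     else
       if j < q1 then A31 $$ (i - p1 - p2, j) else if j < q1 + q2 then A32 $$ (i - p1 - p2, j - q1)
       else A33 $$ (i - p1 - p2, j - q1 - q2))"
  using assms by (auto simp: nine_block_mat_def append_cols_def append_rows_def)

definition defect :: "complex \<Rightarrow> complex" where
  "defect s = complex_of_real (sqrt (1 - (cmod s)\<^sup>2))"

definition solves_factorization ::
  "nat \<Rightarrow> complex \<Rightarrow> complex mat \<Rightarrow> complex mat \<Rightarrow> complex mat \<Rightarrow> complex mat \<Rightarrow> complex mat \<Rightarrow> bool" where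
  "solves_factorization n s U \<alpha> \<beta> \<gamma> \<delta> \<longleftrightarrow>
     \<alpha> \<in> carrier_mat 1 1 \<and> \<beta> \<in> carrier_mat 1 (n - 1) \<and>
     \<gamma> \<in> carrier_mat (n - 1) 1 \<and> \<delta> \<in> carrier_mat (n - 1) (n - 1) \<and>
     U =
       nine_block_mat
         (mat11 1)        (mat11 0) (0\<^sub>m 1 (n - 1))
         (mat11 0)        \<alpha>         \<beta>
         (0\<^sub>m (n - 1) 1)  \<gamma>         \<delta>
       * nine_block_mat
         (mat11 s)          (mat11 (defect s)) (0\<^sub>m 1 (n - 1))
         (mat11 (defect s)) (mat11 (- cnj s))  (0\<^sub>m 1 (n - 1))
         (0\<^sub>m (n - 1) 1)    (0\<^sub>m (n - 1) 1)    (1\<^sub>m (n - 1))"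

end

theory Submission
  imports Defs
begin

text \<open>The nontrivial part of the second factor is the two by two matrix with rows \<open>(s, d)\<close> and
  \<open>(d, - cnj s)\<close>, where \<open>s = s\<^sub>0\<close> and \<open>d = defect s\<close>. It is unitary, as \<open>d\<^sup>2 + s * cnj s = 1\<close>.
  Multiplying out the blocks (\<open>solves_factorization_iff\<close>) turns the equation into
  \<open>c\<^sub>1 = d \<alpha>\<close>, \<open>d\<^sub>1\<^sub>1 = - cnj s \<alpha>\<close>, \<open>c\<^sub>2 = d \<gamma>\<close>, \<open>d\<^sub>2\<^sub>1 = - cnj s \<gamma>\<close>, \<open>d\<^sub>1\<^sub>2 = \<beta>\<close>, \<open>d\<^sub>2\<^sub>2 = \<delta>\<close>.
  Entry by entry, a pair of equations \<open>a = d x\<close>, \<open>b = - cnj s x\<close> says that the vector \<open>(a, b)\<close> is \<open>x\<close>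
  times the unit vector \<open>(d, - cnj s)\<close>. The only possible \<open>x\<close> is the inner product \<open>d a - s b\<close>, and it
  works if and only if \<open>(a, b)\<close> is orthogonal to \<open>(s, d)\<close>, that is, \<open>cnj s a + d b = 0\<close>
  (\<open>eq_multiples_second_row_iff\<close>). This orthogonality holds because the rows of a unitary matrix
  are orthogonal and the first row of \<open>U\<^sub>0\<close> vanishes beyond its first two entries \<open>s\<close> and \<open>d\<close>
  (\<open>unitary_nine_block_rows_orthogonal\<close>).\<close>

section \<open>Three by three block matrices\<close>

lemma sum_split_three:
  fixes f :: "nat \<Rightarrow> 'a :: comm_monoid_add"
  shows "sum f {0..<p + q + r} =
    (\<Sum>k = 0..<p. f k) + (\<Sum>k = 0..<q. f (p + k)) + (\<Sum>k = 0..<r. f (p + q + k))"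
proof -
  have shift: "sum f {m..<m + l} = (\<Sum>k = 0..<l. f (m + k))" for m l
    using sum.shift_bounds_nat_ivl[of f 0 m l] by (simp add: add.commute)
  have "sum f {0..<p + q + r} = sum f {0..<p} + sum f {p..<p + q} + sum f {p + q..<p + q + r}"
    by (simp add: sum.atLeastLessThan_concat)
  then show ?thesis
    by (simp only: shift)
qed

lemma mult_nine_block_mat:
  fixes A11 :: "'a :: semiring_0 mat"
  assumes A: "A11 \<in> carrier_mat p1 q1" "A12 \<in> carrier_mat p1 q2" "A13 \<in> carrier_mat p1 q3"
      "A21 \<in> carrier_mat p2 q1" "A22 \<in> carrier_mat p2 q2" "A23 \<in> carrier_mat p2 q3"
      "A31 \<in> carrier_mat p3 q1" "A32 \<in> carrier_mat p3 q2" "A33 \<in> carrier_mat p3 q3"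
    and B: "B11 \<in> carrier_mat q1 r1" "B12 \<in> carrier_mat q1 r2" "B13 \<in> carrier_mat q1 r3"
      "B21 \<in> carrier_mat q2 r1" "B22 \<in> carrier_mat q2 r2" "B23 \<in> carrier_mat q2 r3"
      "B31 \<in> carrier_mat q3 r1" "B32 \<in> carrier_mat q3 r2" "B33 \<in> carrier_mat q3 r3"
  shows "nine_block_mat A11 A12 A13 A21 A22 A23 A31 A32 A33 *
      nine_block_mat B11 B12 B13 B21 B22 B23 B31 B32 B33 =
    nine_block_mat
      (A11 * B11 + A12 * B21 + A13 * B31) (A11 * B12 + A12 * B22 + A13 * B32)
        (A11 * B13 + A12 * B23 + A13 * B33)
      (A21 * B11 + A22 * B21 + A23 * B31) (A21 * B12 + A22 * B22 + A23 * B32)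
        (A21 * B13 + A22 * B23 + A23 * B33)
      (A31 * B11 + A32 * B21 + A33 * B31) (A31 * B12 + A32 * B22 + A33 * B32)
        (A31 * B13 + A32 * B23 + A33 * B33)" (is "?A * ?B = ?C")
proof (rule eq_matI)
  have carriers: "?A \<in> carrier_mat (p1 + p2 + p3) (q1 + q2 + q3)"
    "?B \<in> carrier_mat (q1 + q2 + q3) (r1 + r2 + r3)"
    "?C \<in> carrier_mat (p1 + p2 + p3) (r1 + r2 + r3)"
    using A B by (intro nine_block_mat_carrier; simp)+
  then show "dim_row (?A * ?B) = dim_row ?C" "dim_col (?A * ?B) = dim_col ?C"
    by auto
  fix i j assume "i < dim_row ?C" "j < dim_col ?C"
  with carriers have i: "i < p1 + p2 + p3" and j: "j < r1 + r2 + r3"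
    by auto
  have dims: "dim_row ?A = p1 + p2 + p3" "dim_col ?B = r1 + r2 + r3" "dim_row ?B = q1 + q2 + q3"
     "dim_col ?A = q1 + q2 + q3"
    using carriers by auto
  \<comment> \<open>The size of a sum of products of matrices is read off the last summand.\<close>
  have C: "X * Y + Z * W + P * Q \<in> carrier_mat a b"
    if "P \<in> carrier_mat a c" "Q \<in> carrier_mat c b" for X Y Z W P Q :: "'a mat" and a b c
    using that by auto
  have "(?A * ?B) $$ (i, j) = (\<Sum>k = 0..<q1 + q2 + q3. ?A $$ (i, k) * ?B $$ (k, j))"
    using i j dims by (simp add: scalar_prod_def)
  also have "\<dots> = ?C $$ (i, j)"
    using i j A B
    by (simp add: sum_split_three nine_block_mat_index[OF A] nine_block_mat_index[OF B]
        nine_block_mat_index[OF C C C C C C C C C, OF A(3) B(7) A(3) B(8) A(3) B(9)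
         A(6) B(7) A(6) B(8) A(6) B(9) A(9) B(7) A(9) B(8) A(9) B(9)] scalar_prod_def)
  finally show "(?A * ?B) $$ (i, j) = ?C $$ (i, j)" .
qed

lemma nine_block_mat_inject:
  assumes A: "A11 \<in> carrier_mat p1 q1" "A12 \<in> carrier_mat p1 q2" "A13 \<in> carrier_mat p1 q3"
      "A21 \<in> carrier_mat p2 q1" "A22 \<in> carrier_mat p2 q2" "A23 \<in> carrier_mat p2 q3"
      "A31 \<in> carrier_mat p3 q1" "A32 \<in> carrier_mat p3 q2" "A33 \<in> carrier_mat p3 q3"
    and B: "B11 \<in> carrier_mat p1 q1" "B12 \<in> carrier_mat p1 q2" "B13 \<in> carrier_mat p1 q3"
      "B21 \<in> carrier_mat p2 q1" "B22 \<in> carrier_mat p2 q2" "B23 \<in> carrier_mat p2 q3"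
      "B31 \<in> carrier_mat p3 q1" "B32 \<in> carrier_mat p3 q2" "B33 \<in> carrier_mat p3 q3"
  shows "nine_block_mat A11 A12 A13 A21 A22 A23 A31 A32 A33 =
      nine_block_mat B11 B12 B13 B21 B22 B23 B31 B32 B33 \<longleftrightarrow>
    A11 = B11 \<and> A12 = B12 \<and> A13 = B13 \<and> A21 = B21 \<and> A22 = B22 \<and> A23 = B23 \<and>
    A31 = B31 \<and> A32 = B32 \<and> A33 = B33" (is "?A = ?B \<longleftrightarrow> ?R")
proof
  assume eq: "?A = ?B"
  have entry: "?A $$ (a + i, b + j) = ?B $$ (a + i, b + j)" for a b i j
    by (simp add: eq)
  note ix = nine_block_mat_index[OF A] nine_block_mat_index[OF B]
  have blocks:
    "\<And>i j. i < p1 \<Longrightarrow> j < q1 \<Longrightarrow> A11 $$ (i, j) = B11 $$ (i, j)"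
    "\<And>i j. i < p1 \<Longrightarrow> j < q2 \<Longrightarrow> A12 $$ (i, j) = B12 $$ (i, j)"
    "\<And>i j. i < p1 \<Longrightarrow> j < q3 \<Longrightarrow> A13 $$ (i, j) = B13 $$ (i, j)"
    "\<And>i j. i < p2 \<Longrightarrow> j < q1 \<Longrightarrow> A21 $$ (i, j) = B21 $$ (i, j)"
    "\<And>i j. i < p2 \<Longrightarrow> j < q2 \<Longrightarrow> A22 $$ (i, j) = B22 $$ (i, j)"
    "\<And>i j. i < p2 \<Longrightarrow> j < q3 \<Longrightarrow> A23 $$ (i, j) = B23 $$ (i, j)"
    "\<And>i j. i < p3 \<Longrightarrow> j < q1 \<Longrightarrow> A31 $$ (i, j) = B31 $$ (i, j)"
    "\<And>i j. i < p3 \<Longrightarrow> j < q2 \<Longrightarrow> A32 $$ (i, j) = B32 $$ (i, j)"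
    "\<And>i j. i < p3 \<Longrightarrow> j < q3 \<Longrightarrow> A33 $$ (i, j) = B33 $$ (i, j)"
    subgoal for i j using entry[of 0 i 0 j] by (simp add: ix)
    subgoal for i j using entry[of 0 i q1 j] by (simp add: ix)
    subgoal for i j using entry[of 0 i "q1 + q2" j] by (simp add: ix)
    subgoal for i j using entry[of p1 i 0 j] by (simp add: ix)
    subgoal for i j using entry[of p1 i q1 j] by (simp add: ix)
    subgoal for i j using entry[of p1 i "q1 + q2" j] by (simp add: ix)
    subgoal for i j using entry[of "p1 + p2" i 0 j] by (simp add: ix)
    subgoal for i j using entry[of "p1 + p2" i q1 j] by (simp add: ix)
    subgoal for i j using entry[of "p1 + p2" i "q1 + q2" j] by (simp add: ix)
    done
  show ?R
    using A B by (auto intro!: eq_matI simp: blocks)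
qed simp

section \<open>The factorization as a system of block equations\<close>

lemma mat11_carrier: "mat11 z \<in> carrier_mat 1 1"
  by (simp add: mat11_def)

lemma mat11_0: "mat11 0 = 0\<^sub>m 1 1"
  by (simp add: mat11_def zero_mat_def)

lemma mat11_1: "mat11 1 = 1\<^sub>m 1"
  by (rule eq_matI) (auto simp: mat11_def)

lemma smult_one_mat_1: "z \<cdot>\<^sub>m 1\<^sub>m 1 = mat11 z"
  by (rule eq_matI) (auto simp: mat11_def)

lemma mult_mat11_right:
  assumes "A \<in> carrier_mat m 1"
  shows "A * mat11 z = z \<cdot>\<^sub>m A"
  by (rule eq_matI) (use assms in \<open>auto simp: mat11_def scalar_prod_def\<close>)

lemma solves_factorization_iff:
  assumes c1: "c1 \<in> carrier_mat 1 1" and d11: "d11 \<in> carrier_mat 1 1"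
    and d12: "d12 \<in> carrier_mat 1 (n - 1)"
    and c2: "c2 \<in> carrier_mat (n - 1) 1" and d21: "d21 \<in> carrier_mat (n - 1) 1"
    and d22: "d22 \<in> carrier_mat (n - 1) (n - 1)"
  shows "solves_factorization n s
      (nine_block_mat (mat11 s) (mat11 (defect s)) (0\<^sub>m 1 (n - 1)) c1 d11 d12 c2 d21 d22) \<alpha> \<beta> \<gamma> \<delta> \<longleftrightarrow>
    \<alpha> \<in> carrier_mat 1 1 \<and> \<gamma> \<in> carrier_mat (n - 1) 1 \<and>
    c1 = defect s \<cdot>\<^sub>m \<alpha> \<and> d11 = - cnj s \<cdot>\<^sub>m \<alpha> \<and> d12 = \<beta> \<and>
    c2 = defect s \<cdot>\<^sub>m \<gamma> \<and> d21 = - cnj s \<cdot>\<^sub>m \<gamma> \<and> d22 = \<delta>"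
proof (cases "\<alpha> \<in> carrier_mat 1 1 \<and> \<beta> \<in> carrier_mat 1 (n - 1) \<and>
    \<gamma> \<in> carrier_mat (n - 1) 1 \<and> \<delta> \<in> carrier_mat (n - 1) (n - 1)")
  case True
  then have \<alpha>: "\<alpha> \<in> carrier_mat 1 1" and \<beta>: "\<beta> \<in> carrier_mat 1 (n - 1)"
    and \<gamma>: "\<gamma> \<in> carrier_mat (n - 1) 1" and \<delta>: "\<delta> \<in> carrier_mat (n - 1) (n - 1)"
    by auto
  have "nine_block_mat (mat11 1) (mat11 0) (0\<^sub>m 1 (n - 1)) (mat11 0) \<alpha> \<beta> (0\<^sub>m (n - 1) 1) \<gamma> \<delta> *
      nine_block_mat (mat11 s) (mat11 (defect s)) (0\<^sub>m 1 (n - 1))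
        (mat11 (defect s)) (mat11 (- cnj s)) (0\<^sub>m 1 (n - 1))
        (0\<^sub>m (n - 1) 1) (0\<^sub>m (n - 1) 1) (1\<^sub>m (n - 1)) =
    nine_block_mat (mat11 s) (mat11 (defect s)) (0\<^sub>m 1 (n - 1))
      (defect s \<cdot>\<^sub>m \<alpha>) (- cnj s \<cdot>\<^sub>m \<alpha>) \<beta> (defect s \<cdot>\<^sub>m \<gamma>) (- cnj s \<cdot>\<^sub>m \<gamma>) \<delta>"
    using \<alpha> \<beta> \<gamma> \<delta>
    by (subst mult_nine_block_mat[where ?p1.0 = 1 and ?p2.0 = 1 and ?p3.0 = "n - 1" and
          ?q1.0 = 1 and ?q2.0 = 1 and ?q3.0 = "n - 1" and ?r1.0 = 1 and ?r2.0 = 1 and ?r3.0 = "n - 1"])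
      (simp_all add: mat11_carrier[simplified] mat11_0 mat11_1 smult_one_mat_1[simplified]
        mult_mat11_right[of _ 1] mult_mat11_right[of _ "n - 1"]
        left_mult_one_mat[of _ 1 1] left_mult_zero_mat[of _ 1] right_add_zero_mat[of _ 1 1])
  moreover have "nine_block_mat (mat11 s) (mat11 (defect s)) (0\<^sub>m 1 (n - 1)) c1 d11 d12 c2 d21 d22 =
      nine_block_mat (mat11 s) (mat11 (defect s)) (0\<^sub>m 1 (n - 1))
        (defect s \<cdot>\<^sub>m \<alpha>) (- cnj s \<cdot>\<^sub>m \<alpha>) \<beta> (defect s \<cdot>\<^sub>m \<gamma>) (- cnj s \<cdot>\<^sub>m \<gamma>) \<delta> \<longleftrightarrow>
    c1 = defect s \<cdot>\<^sub>m \<alpha> \<and> d11 = - cnj s \<cdot>\<^sub>m \<alpha> \<and> d12 = \<beta> \<and>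
    c2 = defect s \<cdot>\<^sub>m \<gamma> \<and> d21 = - cnj s \<cdot>\<^sub>m \<gamma> \<and> d22 = \<delta>"
    using assms \<alpha> \<beta> \<gamma> \<delta>
    by (subst nine_block_mat_inject[where ?p1.0 = 1 and ?p2.0 = 1 and ?p3.0 = "n - 1" and
          ?q1.0 = 1 and ?q2.0 = 1 and ?q3.0 = "n - 1"]) (simp_all add: mat11_carrier[simplified])
  ultimately show ?thesis
    using True by (simp add: solves_factorization_def)
next
  case False
  with d12 d22 show ?thesis
    by (auto simp: solves_factorization_def)
qed

section \<open>Solving the equations of one column\<close>

lemma cnj_defect [simp]: "cnj (defect s) = defect s"
  by (simp add: defect_def)

lemma defect_squared:
  assumes "cmod s \<le> 1"
  shows "defect s * defect s + s * cnj s = 1"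
proof -
  have "(sqrt (1 - (cmod s)\<^sup>2))\<^sup>2 = 1 - (cmod s)\<^sup>2"
    using assms by (simp add: abs_square_le_1)
  then have "defect s * defect s = 1 - of_real ((cmod s)\<^sup>2)"
    by (metis defect_def of_real_1 of_real_diff of_real_mult power2_eq_square)
  then show ?thesis
    by (simp flip: complex_norm_square)
qed

text \<open>Here \<open>a\<close> and \<open>b\<close> stand for corresponding blocks in the first two block columns of \<open>U\<^sub>0\<close>, and \<open>x\<close>
  for the unknown block \<open>\<alpha>\<close> or \<open>\<gamma>\<close>. The orthogonality assumption only serves the implication from
  right to left, that is, the existence of a solution.\<close>

lemma eq_multiples_second_row_iff:
  assumes s: "cmod s \<le> 1" and a: "a \<in> carrier_mat m k" and b: "b \<in> carrier_mat m k"
    and x: "x \<in> carrier_mat m k"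
    and orth: "cnj s \<cdot>\<^sub>m a + defect s \<cdot>\<^sub>m b = 0\<^sub>m m k"
  shows "a = defect s \<cdot>\<^sub>m x \<and> b = - cnj s \<cdot>\<^sub>m x \<longleftrightarrow> x = - (s \<cdot>\<^sub>m b) + defect s \<cdot>\<^sub>m a"
proof (intro iffI conjI)
  assume eq: "a = defect s \<cdot>\<^sub>m x \<and> b = - cnj s \<cdot>\<^sub>m x"
  have "- (s * (- cnj s * z)) + defect s * (defect s * z) = (defect s * defect s + s * cnj s) * z" for z
    by (simp add: algebra_simps)
  then have "- (s * (- cnj s * z)) + defect s * (defect s * z) = z" for z
    using defect_squared[OF s] by simp
  then show "x = - (s \<cdot>\<^sub>m b) + defect s \<cdot>\<^sub>m a"
    using x by (intro eq_matI) (auto simp: eq)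
next
  assume eq: "x = - (s \<cdot>\<^sub>m b) + defect s \<cdot>\<^sub>m a"
  have zero: "cnj s * a $$ (i, j) + defect s * b $$ (i, j) = 0" if "i < m" "j < k" for i j
    using arg_cong[OF orth, of "\<lambda>M. M $$ (i, j)"] that a b by simp
  have "z = defect s * (- (s * w) + defect s * z)" "w = - cnj s * (- (s * w) + defect s * z)"
    if "cnj s * z + defect s * w = 0" for z w
  proof -
    have "defect s * (- (s * w) + defect s * z) =
        (defect s * defect s + s * cnj s) * z - s * (cnj s * z + defect s * w)"
      by (simp add: algebra_simps)
    then show "z = defect s * (- (s * w) + defect s * z)"
      using defect_squared[OF s] that by simp
    have "- cnj s * (- (s * w) + defect s * z) =
        (defect s * defect s + s * cnj s) * w - defect s * (cnj s * z + defect s * w)"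
      by (simp add: algebra_simps)
    then show "w = - cnj s * (- (s * w) + defect s * z)"
      using defect_squared[OF s] that by simp
  qed
  with zero show "a = defect s \<cdot>\<^sub>m x" "b = - cnj s \<cdot>\<^sub>m x"
    unfolding eq using a b by (auto intro!: eq_matI)
qed

section \<open>Orthogonality of the rows of a unitary matrix\<close>

lemma unitary_mat_rows_orthogonal:
  assumes U: "unitary_mat m U" and i: "i < m" and k: "k < m" and "i \<noteq> k"
  shows "(\<Sum>j = 0..<m. U $$ (i, j) * cnj (U $$ (k, j))) = 0"
proof -
  have carrier: "U \<in> carrier_mat m m"
    using U by (simp add: unitary_mat_def)
  have "(U * mat_adjoint U) $$ (i, k) = 0"
    using assms by (simp add: unitary_mat_def)
  then show ?thesis
    using carrier i k by (simp add: mat_adjoint_def scalar_prod_def mat_of_rows_def)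
qed

text \<open>The zero block makes the inner product with the first row involve two columns only.\<close>

lemma unitary_nine_block_rows_orthogonal:
  assumes c1: "c1 \<in> carrier_mat 1 1" and d11: "d11 \<in> carrier_mat 1 1"
    and d12: "d12 \<in> carrier_mat 1 m"
    and c2: "c2 \<in> carrier_mat m 1" and d21: "d21 \<in> carrier_mat m 1"
    and d22: "d22 \<in> carrier_mat m m"
    and U: "unitary_mat (1 + 1 + m) (nine_block_mat (mat11 s) (mat11 t) (0\<^sub>m 1 m) c1 d11 d12 c2 d21 d22)"
      (is "unitary_mat _ ?U")
  shows "cnj s \<cdot>\<^sub>m c1 + cnj t \<cdot>\<^sub>m d11 = 0\<^sub>m 1 1" "cnj s \<cdot>\<^sub>m c2 + cnj t \<cdot>\<^sub>m d21 = 0\<^sub>m m 1"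
proof -
  note ix = nine_block_mat_index[OF mat11_carrier mat11_carrier zero_carrier_mat
    c1 d11 d12 c2 d21 d22, of _ _ s t]
  have first_row: "?U $$ (0, 0) = s" "?U $$ (0, 1) = t" "\<And>j. j < m \<Longrightarrow> ?U $$ (0, 2 + j) = 0"
    by (subst ix; simp add: mat11_def)+
  have orth: "?U $$ (i, 0) * cnj s + ?U $$ (i, 1) * cnj t = 0" if "0 < i" "i < 1 + 1 + m" for i
  proof -
    have "(\<Sum>j = 0..<1 + 1 + m. ?U $$ (i, j) * cnj (?U $$ (0, j))) =
        ?U $$ (i, 0) * cnj s + ?U $$ (i, 1) * cnj t"
      unfolding sum_split_three using first_row by simp
    then show ?thesis
      using unitary_mat_rows_orthogonal[OF U that(2), of 0] that(1) by simp
  qed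
  show "cnj s \<cdot>\<^sub>m c1 + cnj t \<cdot>\<^sub>m d11 = 0\<^sub>m 1 1"
    using c1 d11 orth[of 1] by (intro eq_matI) (auto simp: ix[simplified] algebra_simps)
  show "cnj s \<cdot>\<^sub>m c2 + cnj t \<cdot>\<^sub>m d21 = 0\<^sub>m m 1"
  proof (rule eq_matI)
    fix i j assume "i < dim_row (0\<^sub>m m 1 :: complex mat)" "j < dim_col (0\<^sub>m m 1 :: complex mat)"
    then have "i < m" "j = 0"
      by auto
    then show "(cnj s \<cdot>\<^sub>m c2 + cnj t \<cdot>\<^sub>m d21) $$ (i, j) = 0\<^sub>m m 1 $$ (i, j)"
      using orth[of "2 + i"] c2 d21 by (simp add: ix[simplified] algebra_simps)
  qed (use c2 d21 in auto)
qed

section \<open>Existence and uniqueness of the factor\<close>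

theorem theorem7p1:
  fixes n :: nat and s\<^sub>0 :: complex
    and U\<^sub>0 c\<^sub>1 c\<^sub>2 d\<^sub>1\<^sub>1 d\<^sub>1\<^sub>2 d\<^sub>2\<^sub>1 d\<^sub>2\<^sub>2 :: "complex mat"
  assumes "n \<ge> 2" and "cmod s\<^sub>0 \<le> 1"
    and "c\<^sub>1 \<in> carrier_mat 1 1" and "d\<^sub>1\<^sub>1 \<in> carrier_mat 1 1" and "d\<^sub>1\<^sub>2 \<in> carrier_mat 1 (n - 1)"
    and "c\<^sub>2 \<in> carrier_mat (n - 1) 1" and "d\<^sub>2\<^sub>1 \<in> carrier_mat (n - 1) 1"
    and "d\<^sub>2\<^sub>2 \<in> carrier_mat (n - 1) (n - 1)"
    and "U\<^sub>0 = nine_block_mat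
           (mat11 s\<^sub>0) (mat11 (defect s\<^sub>0)) (0\<^sub>m 1 (n - 1))
           c\<^sub>1         d\<^sub>1\<^sub>1                d\<^sub>1\<^sub>2
           c\<^sub>2         d\<^sub>2\<^sub>1                d\<^sub>2\<^sub>2"
    and "unitary_mat (n + 1) U\<^sub>0"
  shows "(\<exists>\<alpha> \<beta> \<gamma> \<delta>. solves_factorization n s\<^sub>0 U\<^sub>0 \<alpha> \<beta> \<gamma> \<delta>) \<and>
    (\<forall>\<alpha> \<beta> \<gamma> \<delta>. solves_factorization n s\<^sub>0 U\<^sub>0 \<alpha> \<beta> \<gamma> \<delta> \<longrightarrow>
       four_block_mat \<alpha> \<beta> \<gamma> \<delta> =
       four_block_mat
         (- (s\<^sub>0 \<cdot>\<^sub>m d\<^sub>1\<^sub>1) + defect s\<^sub>0 \<cdot>\<^sub>m c\<^sub>1) d\<^sub>1\<^sub>2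
         (- (s\<^sub>0 \<cdot>\<^sub>m d\<^sub>2\<^sub>1) + defect s\<^sub>0 \<cdot>\<^sub>m c\<^sub>2) d\<^sub>2\<^sub>2)"
proof -
  have n: "n + 1 = 1 + 1 + (n - 1)"
    using assms(1) by simp
  note orth = unitary_nine_block_rows_orthogonal[OF assms(3-8) assms(10)[unfolded assms(9) n],
      unfolded cnj_defect]
  have solves_iff: "solves_factorization n s\<^sub>0 U\<^sub>0 \<alpha> \<beta> \<gamma> \<delta> \<longleftrightarrow>
      \<alpha> = - (s\<^sub>0 \<cdot>\<^sub>m d\<^sub>1\<^sub>1) + defect s\<^sub>0 \<cdot>\<^sub>m c\<^sub>1 \<and> \<beta> = d\<^sub>1\<^sub>2 \<and>
      \<gamma> = - (s\<^sub>0 \<cdot>\<^sub>m d\<^sub>2\<^sub>1) + defect s\<^sub>0 \<cdot>\<^sub>m c\<^sub>2 \<and> \<delta> = d\<^sub>2\<^sub>2" (is "_ \<longleftrightarrow> ?R") for \<alpha> \<beta> \<gamma> \<delta>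
  proof -
    have carriers: "\<alpha> \<in> carrier_mat 1 1 \<and> \<gamma> \<in> carrier_mat (n - 1) 1" if ?R
      using that assms(3-8) by auto
    show ?thesis
      unfolding assms(9) solves_factorization_iff[OF assms(3-8)]
      using eq_multiples_second_row_iff[OF assms(2,3,4) _ orth(1), of \<alpha>]
        eq_multiples_second_row_iff[OF assms(2,6,7) _ orth(2), of \<gamma>] carriers
      by blast
  qed
  then show ?thesis
    by simp
qed

end
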